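(* Let $G$ be a finitely generated group with subexponential growth. Then $G$ has the patching property.
   Context: Fix a finite symmetric generating set of $G$, and let $B_r$ be the ball of radius $r$ around $1_G$ for the left-invariant word metric. $G$ has subexponential growth if it does not have exponential growth, i.e. there is no $\alpha > 1$ with $|B_k| \geq \alpha^k$ for all $k \in \mathbb{N}$. For $A \subset G$ write $A^{\circ r} = \{a \in G : aB_r \subset A\}$. The $r$-almost-union of $A, B \subset G$ is $$A \overset{r}{\cup} B = A^{\circ r} \cup B^{\circ r} \cup \big((A \cup B) \setminus (AB_r \cap BB_r)\big).$$ For $r, R \in \mathbb{N}$ let $\mathcal{C}_{r,R}$ be the smallest family of subsets of $G$ which contains all left translates $aB_R$, $a \in G$, and is closed under the $r$-almost-union operation and under taking subsets. $G$ has the patching property if for all $r$ there exists $R$ such that $\mathcal{C}_{r,R}$ contains all balls of radius larger than $R$. (This does not depend on the choice of generating set.) *)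

theory Defs
  imports Complex_Main "HOL-Algebra.Generated_Groups"
begin

definition fin_sym_gen_set :: "('a, 'b) monoid_scheme \<Rightarrow> 'a set \<Rightarrow> bool" where
  "fin_sym_gen_set G S \<longleftrightarrow>
     finite S \<and> S \<subseteq> carrier G \<and> (\<forall>s\<in>S. inv\<^bsub>G\<^esub> s \<in> S) \<and> generate G S = carrier G"

text \<open>
  The word length is the least length of a word over \<open>S\<close> representing the element. For a
  symmetric generating set \<open>S\<close>, words without formal inverses suffice, and every
  element of the carrier is represented by some word. The word metric is the left-invariant
  one, i.e. the distance from \<open>g\<close> to \<open>h\<close> is the length of the inverse of \<open>g\<close> times \<open>h\<close>.
\<close>

definition word_length :: "('a, 'b) monoid_scheme \<Rightarrow> 'a set \<Rightarrow> 'a \<Rightarrow> nat" where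
  "word_length G S g =
     (LEAST n. \<exists>ws. set ws \<subseteq> S \<and> length ws = n \<and> foldr (\<lambda>s t. s \<otimes>\<^bsub>G\<^esub> t) ws \<one>\<^bsub>G\<^esub> = g)"

definition word_dist :: "('a, 'b) monoid_scheme \<Rightarrow> 'a set \<Rightarrow> 'a \<Rightarrow> 'a \<Rightarrow> nat" where
  "word_dist G S g h = word_length G S (inv\<^bsub>G\<^esub> g \<otimes>\<^bsub>G\<^esub> h)"

definition word_ball :: "('a, 'b) monoid_scheme \<Rightarrow> 'a set \<Rightarrow> nat \<Rightarrow> 'a set" where
  "word_ball G S r = {g \<in> carrier G. word_dist G S \<one>\<^bsub>G\<^esub> g \<le> r}"

definition exponential_growth :: "('a, 'b) monoid_scheme \<Rightarrow> 'a set \<Rightarrow> bool" where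
  "exponential_growth G S \<longleftrightarrow>
     (\<exists>\<alpha>::real. \<alpha> > 1 \<and> (\<forall>k::nat. real (card (word_ball G S k)) \<ge> \<alpha> ^ k))"

definition subexponential_growth :: "('a, 'b) monoid_scheme \<Rightarrow> 'a set \<Rightarrow> bool" where
  "subexponential_growth G S \<longleftrightarrow> \<not> exponential_growth G S"

definition r_interior :: "('a, 'b) monoid_scheme \<Rightarrow> 'a set \<Rightarrow> nat \<Rightarrow> 'a set \<Rightarrow> 'a set" where
  "r_interior G S r A = {a \<in> carrier G. a <#\<^bsub>G\<^esub> word_ball G S r \<subseteq> A}"

definition almost_union ::
    "('a, 'b) monoid_scheme \<Rightarrow> 'a set \<Rightarrow> nat \<Rightarrow> 'a set \<Rightarrow> 'a set \<Rightarrow> 'a set" where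
  "almost_union G S r A B =
     r_interior G S r A \<union> r_interior G S r B \<union>
     ((A \<union> B) - ((A <#>\<^bsub>G\<^esub> word_ball G S r) \<inter> (B <#>\<^bsub>G\<^esub> word_ball G S r)))"

inductive_set patch_family ::
    "('a, 'b) monoid_scheme \<Rightarrow> 'a set \<Rightarrow> nat \<Rightarrow> nat \<Rightarrow> 'a set set"
  for G :: "('a, 'b) monoid_scheme" and S :: "'a set" and r :: nat and R :: nat where
  translate: "a \<in> carrier G \<Longrightarrow> a <#\<^bsub>G\<^esub> word_ball G S R \<in> patch_family G S r R"
| almost_union: "A \<in> patch_family G S r R \<Longrightarrow> B \<in> patch_family G S r R \<Longrightarrow>
    almost_union G S r A B \<in> patch_family G S r R"
| subset: "A \<in> patch_family G S r R \<Longrightarrow> B \<subseteq> A \<Longrightarrow> B \<in> patch_family G S r R"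

text \<open>
  Balls may have arbitrary centres: by left-invariance of the word metric, the ball of radius
  \<open>n\<close> around \<open>a\<close> is the left translate by \<open>a\<close> of the ball around the identity.
\<close>

definition patching_property :: "('a, 'b) monoid_scheme \<Rightarrow> 'a set \<Rightarrow> bool" where
  "patching_property G S \<longleftrightarrow>
     (\<forall>r. \<exists>R. \<forall>n>R. \<forall>a\<in>carrier G. a <#\<^bsub>G\<^esub> word_ball G S n \<in> patch_family G S r R)"

end

theory Submission
  imports Defs
begin

text \<open>
  Write \<open>b = |B\<^sub>r|\<close>. By subexponential growth and region growing, every finite set \<open>F\<close> has, for
  a bounded radius \<open>\<rho>\<close>, a ball of radius \<open>\<rho>\<close> around any of its points whose outer collar contains
  few points of \<open>F\<close> compared with the ball. Carving off such balls one after another yields a member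
  of the patching family, a union of separated pieces, whose \<open>r\<close>-interior misses at most
  \<open>\<epsilon>|F|\<close> points of \<open>F\<close>. To cover a finite set \<open>X\<close>, first almost cover \<open>X B\<^sub>r\<close> by some \<open>A\<close>; the
  points of \<open>X\<close> outside the \<open>r\<close>-interior of \<open>A\<close> are within \<open>r\<close> of the part of \<open>X B\<^sub>r\<close> missed by
  \<open>A\<close>, and all but a fraction \<open>\<epsilon>\<close> of them are repaired by one almost-union. Each round thus
  multiplies the missed proportion by \<open>\<epsilon> b\<^sup>2\<close>; taking \<open>\<epsilon> b\<^sup>2 = 1/2\<close>, finitely
  many rounds miss nothing, however large \<open>X\<close> is.
\<close>

locale word_metric_group = group G for G (structure) +
  fixes S
  assumes gen_set: "fin_sym_gen_set G S"
begin

section \<open>Words over \<open>S\<close> and the balls they describe\<close>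

abbreviation ball :: "nat \<Rightarrow> 'a set" where
  "ball \<equiv> word_ball G S"

abbreviation word_value :: "'a list \<Rightarrow> 'a" where
  "word_value ws \<equiv> foldr (\<lambda>s t. s \<otimes> t) ws \<one>"

lemma S_carrier: "S \<subseteq> carrier G"
  and S_finite: "finite S"
  and S_inv: "s \<in> S \<Longrightarrow> inv s \<in> S"
  and S_generate: "generate G S = carrier G"
  using gen_set by (auto simp: fin_sym_gen_set_def)

lemma word_value_closed: "set ws \<subseteq> S \<Longrightarrow> word_value ws \<in> carrier G"
  by (induction ws) (use S_carrier in auto)

lemma word_value_append:
  "set us \<subseteq> S \<Longrightarrow> set ws \<subseteq> S \<Longrightarrow> word_value (us @ ws) = word_value us \<otimes> word_value ws"
proof (induction us)
  case (Cons u us)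
  then show ?case
    using S_carrier word_value_closed[of us] word_value_closed[of ws] by (auto simp: m_assoc)
qed (simp add: word_value_closed)

lemma ex_word_inv:
  "set ws \<subseteq> S \<Longrightarrow> \<exists>us. set us \<subseteq> S \<and> length us = length ws \<and> word_value us = inv (word_value ws)"
proof (induction ws)
  case (Cons w ws)
  then obtain us where us: "set us \<subseteq> S" "length us = length ws" "word_value us = inv (word_value ws)"
    by auto
  have w: "w \<in> S" "w \<in> carrier G" using Cons.prems S_carrier by auto
  have "word_value (us @ [inv w]) = inv (word_value (w # ws))"
    using Cons.prems us w S_inv word_value_closed[of ws]
    by (subst word_value_append) (auto simp: inv_mult_group)
  then show ?case
    using us w S_inv by (intro exI[of _ "us @ [inv w]"]) auto
qed simp

lemma ex_word: "g \<in> carrier G \<Longrightarrow> \<exists>ws. set ws \<subseteq> S \<and> word_value ws = g"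
proof -
  assume "g \<in> carrier G"
  then have "g \<in> generate G S" by (simp add: S_generate)
  then show ?thesis
  proof (induction rule: generate.induct)
    case one
    show ?case by (intro exI[of _ "[]"]) simp
  next
    case (incl h)
    then show ?case using S_carrier by (intro exI[of _ "[h]"]) auto
  next
    case (inv h)
    then show ?case using S_carrier S_inv by (intro exI[of _ "[inv h]"]) auto
  next
    case (eng h1 h2)
    then obtain us ws where "set us \<subseteq> S" "word_value us = h1" "set ws \<subseteq> S" "word_value ws = h2"
      by auto
    then show ?case
      by (intro exI[of _ "us @ ws"]) (simp add: word_value_append del: foldr_append)
  qed
qed

text \<open>By \<open>ex_word\<close> the minimum in \<open>word_length\<close> is attained, so
  bounding it is the same as exhibiting a short word. The basic closure properties of balls then
  reduce to operations on lists.\<close>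

lemma ball_eq: "ball r = word_value ` {ws. set ws \<subseteq> S \<and> length ws \<le> r}"
proof -
  have "word_length G S g \<le> r \<longleftrightarrow> (\<exists>ws. set ws \<subseteq> S \<and> length ws \<le> r \<and> word_value ws = g)"
    if g: "g \<in> carrier G" for g
  proof
    let ?P = "\<lambda>n. \<exists>ws. set ws \<subseteq> S \<and> length ws = n \<and> word_value ws = g"
    have "?P (LEAST n. ?P n)"
    proof (rule LeastI_ex)
      show "\<exists>n. ?P n" using ex_word[OF g] by blast
    qed
    then show "\<exists>ws. set ws \<subseteq> S \<and> length ws \<le> r \<and> word_value ws = g" if "word_length G S g \<le> r"
      using that unfolding word_length_def by auto
  next
    assume "\<exists>ws. set ws \<subseteq> S \<and> length ws \<le> r \<and> word_value ws = g"
    then obtain ws where "set ws \<subseteq> S" "length ws \<le> r" "word_value ws = g" by auto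
    then show "word_length G S g \<le> r"
      unfolding word_length_def by (intro order.trans[OF Least_le[of _ "length ws"]]) auto
  qed
  then show ?thesis
    by (auto simp: word_ball_def word_dist_def word_value_closed image_iff) blast+
qed

lemma ball_carrier: "ball r \<subseteq> carrier G"
  by (auto simp: word_ball_def)

lemma ball_closed: "g \<in> ball r \<Longrightarrow> g \<in> carrier G"
  using ball_carrier by blast

lemma finite_ball: "finite (ball r)"
  unfolding ball_eq using finite_lists_length_le[OF S_finite] by simp

lemma one_in_ball: "\<one> \<in> ball r"
  unfolding ball_eq by (rule image_eqI[of _ _ "[]"]) auto

lemma ball_mono: "r \<le> s \<Longrightarrow> ball r \<subseteq> ball s"
  unfolding ball_eq by auto

lemma card_ball_pos: "card (ball r) > 0"
  using one_in_ball finite_ball by (auto simp: card_gt_0_iff)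

lemma inv_in_ball: "g \<in> ball r \<Longrightarrow> inv g \<in> ball r"
proof -
  assume "g \<in> ball r"
  then obtain ws where ws: "set ws \<subseteq> S" "length ws \<le> r" "g = word_value ws"
    unfolding ball_eq by auto
  then obtain us where "set us \<subseteq> S" "length us = length ws" "word_value us = inv g"
    using ex_word_inv[OF ws(1)] by auto
  then show ?thesis
    unfolding ball_eq using ws(2) by (intro image_eqI[of _ _ us]) auto
qed

lemma mult_in_ball: "g \<in> ball r \<Longrightarrow> h \<in> ball s \<Longrightarrow> g \<otimes> h \<in> ball (r + s)"
proof -
  assume "g \<in> ball r" "h \<in> ball s"
  then obtain us ws where "set us \<subseteq> S" "length us \<le> r" "g = word_value us"
    "set ws \<subseteq> S" "length ws \<le> s" "h = word_value ws"
    unfolding ball_eq by auto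
  then show ?thesis
    unfolding ball_eq
    by (intro image_eqI[of _ _ "us @ ws"]) (auto simp: word_value_append simp del: foldr_append)
qed

text \<open>Cut a word of length at most \<open>r + s\<close> after its first \<open>r\<close>
  letters.\<close>

lemma ball_add_subset: "ball (r + s) \<subseteq> ball r <#> ball s"
proof
  fix g assume "g \<in> ball (r + s)"
  then obtain ws where ws: "set ws \<subseteq> S" "length ws \<le> r + s" "g = word_value ws"
    unfolding ball_eq by auto
  have sub: "set (take r ws) \<subseteq> S" "set (drop r ws) \<subseteq> S"
    using ws(1) set_take_subset[of r ws] set_drop_subset[of r ws] by auto
  have "word_value (take r ws) \<in> ball r" "word_value (drop r ws) \<in> ball s"
    unfolding ball_eq using sub ws(2) by (auto intro!: imageI)
  moreover have "g = word_value (take r ws) \<otimes> word_value (drop r ws)"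
    using word_value_append[OF sub] ws(3) by simp
  ultimately show "g \<in> ball r <#> ball s"
    by (auto simp: set_mult_def)
qed

section \<open>Product sets, submultiplicative growth and translates of balls\<close>

lemma set_mult_eq_image: "A <#> B = (\<lambda>(a, b). a \<otimes> b) ` (A \<times> B)"
  by (auto simp: set_mult_def)

lemma finite_set_mult: "finite A \<Longrightarrow> finite B \<Longrightarrow> finite (A <#> B)"
  by (simp add: set_mult_eq_image)

lemma card_set_mult_le: "finite A \<Longrightarrow> finite B \<Longrightarrow> card (A <#> B) \<le> card A * card B"
  unfolding set_mult_eq_image by (metis card_cartesian_product card_image_le finite_cartesian_product)

text \<open>Submultiplicativity turns smallness of one ball, at radius \<open>k\<close>, into a
  bound at all multiples of \<open>k\<close>.\<close>

lemma card_ball_mult_le: "card (ball (m * k)) \<le> card (ball k) ^ m"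
proof (induction m)
  case 0
  have "ball 0 = {\<one>}" by (auto simp: ball_eq)
  then show ?case by simp
next
  case (Suc m)
  have "card (ball (Suc m * k)) \<le> card (ball k <#> ball (m * k))"
    using ball_add_subset[of k "m * k"]
    by (intro card_mono) (auto simp: finite_set_mult finite_ball)
  also have "\<dots> \<le> card (ball k) * card (ball (m * k))"
    by (intro card_set_mult_le finite_ball)
  finally show ?case using Suc.IH by (simp add: order.trans)
qed

lemma mem_l_coset_ball_iff:
  assumes "a \<in> carrier G" "g \<in> carrier G"
  shows "g \<in> a <# ball r \<longleftrightarrow> inv a \<otimes> g \<in> ball r"
proof
  assume "g \<in> a <# ball r"
  then obtain b where "b \<in> ball r" "g = a \<otimes> b" by (auto simp: l_coset_def)
  then show "inv a \<otimes> g \<in> ball r"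
    using assms by (auto simp: m_assoc[symmetric] ball_closed)
next
  assume "inv a \<otimes> g \<in> ball r"
  moreover have "g = a \<otimes> (inv a \<otimes> g)" using assms by (simp add: m_assoc[symmetric])
  ultimately show "g \<in> a <# ball r" by (auto simp: l_coset_def)
qed

lemma self_in_l_coset_ball: "a \<in> carrier G \<Longrightarrow> a \<in> a <# ball r"
  by (simp add: mem_l_coset_ball_iff one_in_ball)

lemma l_coset_ball_carrier: "a \<in> carrier G \<Longrightarrow> a <# ball r \<subseteq> carrier G"
  by (rule l_coset_subset_G[OF ball_carrier])

lemma l_coset_ball_mono: "r \<le> s \<Longrightarrow> a <# ball r \<subseteq> a <# ball s"
  using ball_mono by (auto simp: l_coset_def)

lemma l_coset_ball_eq_image: "a <# ball r = (\<lambda>b. a \<otimes> b) ` ball r"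
  by (auto simp: l_coset_def)

lemma finite_l_coset_ball: "finite (a <# ball r)"
  by (simp add: l_coset_ball_eq_image finite_ball)

lemma card_l_coset_ball_le: "card (a <# ball r) \<le> card (ball r)"
  by (simp add: l_coset_ball_eq_image card_image_le finite_ball)

lemma mult_l_coset_ball:
  assumes "a \<in> carrier G" "g \<in> a <# ball r" "h \<in> ball s"
  shows "g \<otimes> h \<in> a <# ball (r + s)"
proof -
  obtain b where b: "b \<in> ball r" "g = a \<otimes> b" using assms(2) by (auto simp: l_coset_def)
  then have "g \<otimes> h = a \<otimes> (b \<otimes> h)" using assms by (auto simp: m_assoc ball_closed)
  then show ?thesis using mult_in_ball[OF b(1) assms(3)] by (auto simp: l_coset_def)
qed

text \<open>The triangle inequality, used contrapositively below: if \<open>g\<close> is outside the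
  ball of radius \<open>r + s\<close> around \<open>a\<close>, then all points within
  \<open>s\<close> of \<open>g\<close> are outside the ball of radius \<open>r\<close>.\<close>

lemma mult_l_coset_ball_cancel:
  assumes "a \<in> carrier G" "g \<in> carrier G" "h \<in> ball s" "g \<otimes> h \<in> a <# ball r"
  shows "g \<in> a <# ball (r + s)"
proof -
  have "h \<in> carrier G" using assms ball_closed by auto
  then have "g = g \<otimes> h \<otimes> inv h" using assms by (simp add: m_assoc)
  then show ?thesis using mult_l_coset_ball[OF assms(1,4) inv_in_ball[OF assms(3)]] by metis
qed

section \<open>The patching family and separated unions\<close>

lemma patch_family_carrier: "A \<in> patch_family G S r R \<Longrightarrow> A \<subseteq> carrier G"
proof (induction rule: patch_family.induct)
  case (translate a)
  then show ?case by (rule l_coset_ball_carrier)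
next
  case (almost_union A B)
  then show ?case by (auto simp: almost_union_def r_interior_def)
qed auto

lemma empty_in_patch_family: "{} \<in> patch_family G S r R"
  using patch_family.subset[OF patch_family.translate[OF one_closed]] by blast

text \<open>Balls are closed under inverses, so separation is symmetric: no point of
  \<open>A\<close> is within \<open>r\<close> of \<open>B\<close>, nor conversely. Hence the set
  subtracted in the almost-union meets neither \<open>A\<close> nor \<open>B\<close>.\<close>

lemma almost_union_separated:
  assumes "B \<subseteq> carrier G" "B \<inter> (A <#> ball r) = {}"
  shows "A \<union> B \<subseteq> almost_union G S r A B"
proof -
  have "y \<notin> B <#> ball r" if "y \<in> A" for y
  proof
    assume "y \<in> B <#> ball r"
    then obtain u b where ub: "u \<in> B" "b \<in> ball r" "y = u \<otimes> b" by (auto simp: set_mult_def)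
    then have "u = y \<otimes> inv b"
      using assms(1) by (auto simp: m_assoc subset_iff ball_closed)
    then have "u \<in> A <#> ball r"
      using that inv_in_ball[OF ub(2)] by (auto simp: set_mult_def)
    then show False using ub(1) assms(2) by auto
  qed
  then show ?thesis using assms(2) by (auto simp: almost_union_def)
qed

lemma r_interior_mono: "A \<subseteq> B \<Longrightarrow> r_interior G S r A \<subseteq> r_interior G S r B"
  by (auto simp: r_interior_def)

section \<open>Region growing under subexponential growth\<close>

text \<open>If every collar were thick, each enlargement of the radius by \<open>c\<close> would
  multiply the count of points of \<open>F\<close> by \<open>1 + \<epsilon>\<close>, until it
  exceeded the size of the ball. The bound \<open>K\<close> depends on neither \<open>x\<close> nor
  \<open>F\<close>.\<close>

lemma thin_collar:
  assumes "subexponential_growth G S" "\<epsilon> > 0" "c > 0"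
  obtains K where "\<And>x F. x \<in> F \<Longrightarrow> x \<in> carrier G \<Longrightarrow>
    \<exists>\<rho><K. real (card (F \<inter> (x <# ball (\<rho> + c)))) \<le> (1 + \<epsilon>) * real (card (F \<inter> (x <# ball \<rho>)))"
proof -
  \<comment> \<open>The growth rate per unit of radius that amounts to a factor
    \<open>1 + \<epsilon>\<close> per collar of width \<open>c\<close>.\<close>
  define \<alpha> where "\<alpha> = root c (1 + \<epsilon>)"
  have \<alpha>: "\<alpha> > 1" "\<alpha> ^ c = 1 + \<epsilon>"
    using assms by (auto simp: \<alpha>_def real_root_pow_pos2)
  then obtain k where k: "real (card (ball k)) < \<alpha> ^ k"
    using assms(1) by (auto simp: subexponential_growth_def exponential_growth_def not_le)
  have "\<exists>\<rho><c * k. real (card (F \<inter> (x <# ball (\<rho> + c)))) \<le> (1 + \<epsilon>) * real (card (F \<inter> (x <# ball \<rho>)))"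
    if x: "x \<in> F" "x \<in> carrier G" for x F
  proof (rule ccontr)
    let ?f = "\<lambda>\<rho>. real (card (F \<inter> (x <# ball \<rho>)))"
    assume "\<not> ?thesis"
    then have step: "(1 + \<epsilon>) * ?f \<rho> \<le> ?f (\<rho> + c)" if "\<rho> < c * k" for \<rho>
      using that by (meson less_imp_le not_le)
    have "(1 + \<epsilon>) ^ j \<le> ?f (c * j)" if "j \<le> k" for j
      using that
    proof (induction j)
      case 0
      \<comment> \<open>Growth starts from at least one point because the centre itself lies in
        \<open>F\<close>.\<close>
      have "card (F \<inter> (x <# ball 0)) > 0"
        using x self_in_l_coset_ball finite_l_coset_ball by (auto simp: card_gt_0_iff)
      then show ?case by simp
    next
      case (Suc j)
      have "(1 + \<epsilon>) ^ Suc j \<le> (1 + \<epsilon>) * ?f (c * j)"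
        using Suc assms(2) by simp
      also have "\<dots> \<le> ?f (c * j + c)"
        using Suc.prems assms(3) by (intro step) simp
      finally show ?case by (simp add: add.commute)
    qed
    then have "\<alpha> ^ (c * k) \<le> ?f (c * k)"
      using \<alpha> by (simp add: power_mult)
    also have "\<dots> \<le> real (card (ball (c * k)))"
      by (intro of_nat_mono order.trans[OF card_mono card_l_coset_ball_le])
        (auto simp: finite_l_coset_ball)
    also have "\<dots> \<le> real (card (ball k)) ^ c"
      using card_ball_mult_le[of c k] by (metis of_nat_mono of_nat_power)
    also have "\<dots> < (\<alpha> ^ k) ^ c"
      using k assms(3) by (intro power_strict_mono) auto
    finally show False by (simp add: power_mult[symmetric] mult.commute)
  qed
  then show thesis by (rule that)
qed

section \<open>Covering all but a small fraction of a finite set\<close>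

lemma ex_patch_most:
  assumes "subexponential_growth G S" "\<epsilon> > 0"
  obtains R where "\<And>F. finite F \<Longrightarrow> F \<subseteq> carrier G \<Longrightarrow>
    \<exists>U \<in> patch_family G S r R. real (card (F - r_interior G S r U)) \<le> \<epsilon> * real (card F)"
proof -
  \<comment> \<open>The collar width \<open>3 * r\<close> splits in three: one \<open>r\<close> puts
    the carved points into the interior of the new piece, one separates that piece from the rest,
    one keeps the remaining points interior after trimming. \<open>Suc\<close> makes the width
    positive also for \<open>r = 0\<close>.\<close>
  obtain K where K: "\<And>x F. x \<in> F \<Longrightarrow> x \<in> carrier G \<Longrightarrow>
    \<exists>\<rho><K. real (card (F \<inter> (x <# ball (\<rho> + Suc (3 * r))))) \<le> (1 + \<epsilon>) * real (card (F \<inter> (x <# ball \<rho>)))"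
    using thin_collar[OF assms, of "Suc (3 * r)"] by blast
  \<comment> \<open>The piece \<open>P\<close> has radius \<open>\<rho> + r\<close> with
    \<open>\<rho> < K\<close>, hence fits in a translate of the ball of radius
    \<open>K + r\<close>.\<close>
  have "\<exists>U \<in> patch_family G S r (K + r). real (card (F - r_interior G S r U)) \<le> \<epsilon> * real (card F)"
    if "finite F" "F \<subseteq> carrier G" for F
    using that
  proof (induction F rule: finite_psubset_induct)
    case (psubset F)
    show ?case
    proof (cases "F = {}")
      case True
      then show ?thesis using empty_in_patch_family by auto
    next
      case False
      then obtain x where x: "x \<in> F" "x \<in> carrier G" using psubset.prems by auto
      obtain \<rho> where \<rho>: "\<rho> < K" "real (card (F \<inter> (x <# ball (\<rho> + Suc (3 * r)))))
          \<le> (1 + \<epsilon>) * real (card (F \<inter> (x <# ball \<rho>)))"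
        using K[OF x] by blast
      define inner where "inner = F \<inter> (x <# ball \<rho>)"
      define outer where "outer = F \<inter> (x <# ball (\<rho> + Suc (3 * r)))"
      define F1 where "F1 = F - outer"
      have io: "inner \<subseteq> outer" "outer \<subseteq> F"
        using l_coset_ball_mono[of \<rho> "\<rho> + Suc (3 * r)" x] by (auto simp: inner_def outer_def)
      have fin: "finite outer" "finite inner" "finite F1"
        using psubset.hyps(1) by (auto simp: inner_def outer_def F1_def)
      have "x \<in> outer" using x self_in_l_coset_ball by (auto simp: outer_def)
      then have "F1 \<subset> F" using x by (auto simp: F1_def)
      then obtain U1 where U1: "U1 \<in> patch_family G S r (K + r)"
        "real (card (F1 - r_interior G S r U1)) \<le> \<epsilon> * real (card F1)"
        using psubset.IH[of F1] psubset.prems by auto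
      define P where "P = x <# ball (\<rho> + r)"
      \<comment> \<open>Nothing is known about where \<open>U1\<close> lies, so it is trimmed to
        keep it away from \<open>P\<close>.\<close>
      define Q where "Q = U1 - (x <# ball (\<rho> + 2 * r))"
      have "P \<in> patch_family G S r (K + r)"
        unfolding P_def using \<rho>(1)
        by (intro patch_family.subset[OF patch_family.translate[OF x(2)]] l_coset_ball_mono) simp
      moreover have "Q \<in> patch_family G S r (K + r)"
        unfolding Q_def by (intro patch_family.subset[OF U1(1)]) auto
      ultimately have U: "almost_union G S r P Q \<in> patch_family G S r (K + r)"
        by (rule patch_family.almost_union)
      have "Q \<subseteq> carrier G" using patch_family_carrier[OF U1(1)] by (auto simp: Q_def)
      moreover have "P <#> ball r \<subseteq> x <# ball (\<rho> + 2 * r)"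
        using mult_l_coset_ball[OF x(2), of _ "\<rho> + r" _ r]
        by (auto simp: P_def set_mult_def mult_2 add.assoc)
      ultimately have PQ: "P \<union> Q \<subseteq> almost_union G S r P Q"
        by (intro almost_union_separated) (auto simp: Q_def)
      have "inner \<subseteq> r_interior G S r P"
        using psubset.prems mult_l_coset_ball[OF x(2), of _ \<rho> _ r]
        by (auto simp: inner_def r_interior_def P_def l_coset_ball_eq_image[of _ r])
      then have 1: "inner \<subseteq> r_interior G S r (almost_union G S r P Q)"
        using r_interior_mono[of P "almost_union G S r P Q" r] PQ by blast
      \<comment> \<open>Trimming does no harm: a point of \<open>F1\<close> lies outside the ball of
        radius \<open>\<rho> + 3 * r\<close>, so its \<open>r\<close>-ball avoids what was removed
        from \<open>U1\<close>.\<close>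
      have "F1 \<inter> r_interior G S r U1 \<subseteq> r_interior G S r Q"
      proof
        fix y assume y: "y \<in> F1 \<inter> r_interior G S r U1"
        then have yc: "y \<in> carrier G" by (auto simp: r_interior_def)
        have far: "y \<notin> x <# ball (\<rho> + 2 * r + r)"
          using y l_coset_ball_mono[of "\<rho> + 2 * r + r" "\<rho> + Suc (3 * r)" x]
          by (auto simp: F1_def outer_def)
        have "y \<otimes> h \<in> Q" if "h \<in> ball r" for h
        proof -
          have "y \<otimes> h \<in> U1" using y that by (auto simp: r_interior_def l_coset_ball_eq_image)
          then show ?thesis using far mult_l_coset_ball_cancel[OF x(2) yc that] unfolding Q_def by blast
        qed
        then show "y \<in> r_interior G S r Q"
          using yc by (auto simp: r_interior_def l_coset_ball_eq_image[of y r])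
      qed
      then have 2: "F1 \<inter> r_interior G S r U1 \<subseteq> r_interior G S r (almost_union G S r P Q)"
        using r_interior_mono[of Q "almost_union G S r P Q" r] PQ by blast
      \<comment> \<open>The only new loss is the collar \<open>outer - inner\<close>. It is charged
        to \<open>outer\<close>, which is disjoint from \<open>F1\<close>, so the charges of all
        rounds add up to at most \<open>\<epsilon>\<close> times the size of
        \<open>F\<close>.\<close>
      have "F - r_interior G S r (almost_union G S r P Q)
          \<subseteq> (outer - inner) \<union> (F1 - r_interior G S r U1)"
        using 1 2 by (auto simp: F1_def)
      then have "card (F - r_interior G S r (almost_union G S r P Q))
          \<le> card ((outer - inner) \<union> (F1 - r_interior G S r U1))"
        using fin by (intro card_mono) auto
      also have "\<dots> \<le> card (outer - inner) + card (F1 - r_interior G S r U1)"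
        by (rule card_Un_le)
      finally have "real (card (F - r_interior G S r (almost_union G S r P Q)))
          \<le> real (card (outer - inner)) + real (card (F1 - r_interior G S r U1))"
        by linarith
      also have "real (card (outer - inner)) = real (card outer) - real (card inner)"
        using io fin by (simp add: card_Diff_subset card_mono of_nat_diff)
      also have "\<dots> \<le> \<epsilon> * real (card inner)"
        using \<rho>(2) by (simp add: inner_def outer_def algebra_simps)
      also have "\<dots> \<le> \<epsilon> * real (card outer)"
        using io fin assms(2) by (simp add: card_mono)
      also have "\<epsilon> * real (card outer) + real (card (F1 - r_interior G S r U1)) \<le>
          \<epsilon> * real (card outer) + \<epsilon> * real (card F1)"
        using U1(2) by simp
      also have "\<dots> = \<epsilon> * real (card F)"
        using io fin psubset.hyps(1)
        by (simp add: F1_def card_Diff_subset card_mono of_nat_diff algebra_simps)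
      finally show ?thesis using U by auto
    qed
  qed
  then show thesis by (rule that)
qed

section \<open>Iterated repair until nothing is missed\<close>

text \<open>Only the number of rounds depends on \<open>X\<close>; the radius \<open>R\<close> is
  the one supplied by \<open>ex_patch_most\<close> for a fixed \<open>\<epsilon>\<close>.\<close>

lemma ex_finite_in_patch_family:
  assumes "subexponential_growth G S"
  obtains R where "\<And>X. finite X \<Longrightarrow> X \<subseteq> carrier G \<Longrightarrow> X \<in> patch_family G S r R"
proof -
  define b where "b = real (card (ball r))"
  \<comment> \<open>Each round loses two factors \<open>b\<close>: one in passing from
    \<open>X\<close> to \<open>X <#> ball r\<close>, one in bounding \<open>F\<close> by the missed
    set \<open>E\<close>. This choice still leaves a factor \<open>1 / 2\<close>.\<close>
  define \<epsilon> where "\<epsilon> = 1 / (2 * b\<^sup>2)"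
  have b: "b > 0" using card_ball_pos by (simp add: b_def)
  then have \<epsilon>: "\<epsilon> > 0" "\<epsilon> * b * b = 1 / 2"
    by (auto simp: \<epsilon>_def power2_eq_square field_simps)
  obtain R where R: "\<And>F. finite F \<Longrightarrow> F \<subseteq> carrier G \<Longrightarrow>
    \<exists>U \<in> patch_family G S r R. real (card (F - r_interior G S r U)) \<le> \<epsilon> * real (card F)"
    using ex_patch_most[OF assms \<epsilon>(1)] by blast
  \<comment> \<open>\<open>X\<close> must be arbitrary in the induction, since the hypothesis is
    applied to the larger set \<open>X <#> ball r\<close>.\<close>
  have decay: "\<exists>A \<in> patch_family G S r R. real (card (X - A)) \<le> (1 / 2) ^ k * real (card X)"
    if "finite X" "X \<subseteq> carrier G" for X k
    using that
  proof (induction k arbitrary: X)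
    case 0
    show ?case by (rule bexI[OF _ empty_in_patch_family]) simp
  next
    case (Suc k)
    have XB: "finite (X <#> ball r)" "X <#> ball r \<subseteq> carrier G"
      using Suc.prems ball_carrier[of r] by (simp_all add: set_mult_closed finite_set_mult finite_ball)
    obtain A where A: "A \<in> patch_family G S r R"
      "real (card ((X <#> ball r) - A)) \<le> (1 / 2) ^ k * real (card (X <#> ball r))"
      using Suc.IH[OF XB] by blast
    define E where "E = (X <#> ball r) - A"
    define F where "F = X - r_interior G S r A"
    have E: "finite E" using XB by (simp add: E_def)
    \<comment> \<open>A point of \<open>X\<close> outside the interior of \<open>A\<close> has a
      neighbour within \<open>r\<close> that \<open>A\<close> misses, and this neighbour is still in
      \<open>X <#> ball r\<close>. This is why the thickened set was covered first.\<close>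
    have "F \<subseteq> E <#> ball r"
    proof
      fix y assume y: "y \<in> F"
      then have yc: "y \<in> carrier G" "y \<in> X" using Suc.prems by (auto simp: F_def)
      with y obtain h where h: "h \<in> ball r" "y \<otimes> h \<notin> A"
        by (auto simp: F_def r_interior_def l_coset_ball_eq_image)
      have "y \<otimes> h \<in> E" using yc h by (auto simp: E_def set_mult_def)
      moreover have "y = (y \<otimes> h) \<otimes> inv h"
        using yc h by (simp add: m_assoc ball_closed)
      ultimately show "y \<in> E <#> ball r"
        using inv_in_ball[OF h(1)] unfolding set_mult_def by blast
    qed
    then have "card F \<le> card E * card (ball r)"
      using E by (meson card_mono card_set_mult_le finite_ball finite_set_mult order.trans)
    then have F: "real (card F) \<le> real (card E) * b"
      unfolding b_def by (metis of_nat_mono of_nat_mult)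
    obtain U where U: "U \<in> patch_family G S r R"
      "real (card (F - r_interior G S r U)) \<le> \<epsilon> * real (card F)"
      using R[of F] Suc.prems by (auto simp: F_def)
    \<comment> \<open>Interior points of either set survive in the almost-union even if
      \<open>A\<close> and \<open>U\<close> overlap badly.\<close>
    have "X - almost_union G S r A U \<subseteq> F - r_interior G S r U"
      by (auto simp: almost_union_def F_def)
    then have "card (X - almost_union G S r A U) \<le> card (F - r_interior G S r U)"
      using Suc.prems by (intro card_mono) (auto simp: F_def)
    then have "real (card (X - almost_union G S r A U)) \<le> \<epsilon> * real (card F)"
      using U(2) by linarith
    also have "\<dots> \<le> \<epsilon> * (real (card E) * b)"
      using F \<epsilon> by simp
    also have "\<dots> \<le> \<epsilon> * (((1 / 2) ^ k * (real (card X) * b)) * b)"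
    proof -
      have "real (card (X <#> ball r)) \<le> real (card X) * b"
        using card_set_mult_le[OF Suc.prems(1) finite_ball, of r] unfolding b_def
        by (metis of_nat_mono of_nat_mult)
      then have "(1 / 2) ^ k * real (card (X <#> ball r)) \<le> (1 / 2) ^ k * (real (card X) * b)"
        by (intro mult_left_mono) auto
      then have "real (card E) \<le> (1 / 2) ^ k * (real (card X) * b)"
        using A(2) by (simp only: E_def)
      then show ?thesis using \<epsilon> b by (intro mult_left_mono mult_right_mono) auto
    qed
    also have "\<dots> = (\<epsilon> * b * b) * (1 / 2) ^ k * real (card X)"
      by (simp only: ac_simps)
    also have "\<dots> = (1 / 2) ^ Suc k * real (card X)"
      by (simp add: \<epsilon>(2))
    finally show ?case using patch_family.almost_union[OF A(1) U(1)] by blast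
  qed
  have "X \<in> patch_family G S r R" if X: "finite X" "X \<subseteq> carrier G" for X
  proof -
    \<comment> \<open>After \<open>card X\<close> rounds fewer than one point is missed, because
      \<open>n < 2 ^ n\<close>.\<close>
    obtain A where A: "A \<in> patch_family G S r R"
      "real (card (X - A)) \<le> (1 / 2) ^ card X * real (card X)"
      using decay[OF X] by blast
    have "real (card X) < 2 ^ card X" by simp
    then have "(1 / 2) ^ card X * real (card X) < 1"
      by (simp add: power_one_over field_simps)
    then have "card (X - A) = 0" using A(2) by simp
    then show ?thesis using X patch_family.subset[OF A(1)] by simp
  qed
  then show thesis by (rule that)
qed

end

theorem lemma9p14:
  fixes G :: "('a, 'b) monoid_scheme" and S :: "'a set"
  assumes "group G"
    and "fin_sym_gen_set G S"
    and "subexponential_growth G S"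
  shows "patching_property G S"
proof -
  interpret word_metric_group G S
    using assms by (simp add: word_metric_group_def word_metric_group_axioms_def)
  show ?thesis
    unfolding patching_property_def
  proof
    fix r
    obtain R where R: "\<And>X. finite X \<Longrightarrow> X \<subseteq> carrier G \<Longrightarrow> X \<in> patch_family G S r R"
      using ex_finite_in_patch_family[OF assms(3)] by blast
    show "\<exists>R. \<forall>n>R. \<forall>a\<in>carrier G. a <#\<^bsub>G\<^esub> word_ball G S n \<in> patch_family G S r R"
      by (intro exI[of _ R] allI impI ballI R finite_l_coset_ball l_coset_ball_carrier)
  qed
qed

end
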